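(* Let $f\in\mathcal A$ be univalent in $\mathbb D$, with $\dfrac{z}{f(z)}=1+\sum_{n=1}^\infty b_nz^n$ in $\mathbb D$, and define $F$ by $\dfrac{z}{F(z)}=1+\sum_{n=1}^\infty b_{2n}z^n$. Let $r_0\in(0,1)$ be the root of $$\frac{r(1-r^2)^2}{2}\log\left(\frac{1+r}{1-r}\right)-(4+r^4-7r^2)=0,$$ so $r_0\approx0.778387$. Then $F$ belongs to $\mathcal U(1)$ in the disk $|z|<r_0$, i.e. for every $0<r\le r_0$ the function $r^{-1}F(rz)$ belongs to $\mathcal U(1)$; in particular $F$ is univalent in $|z|<r_0$.
   Context: $\mathbb D=\{z\in\mathbb C:|z|<1\}$. $\mathcal A$ is the class of functions $f$ analytic in $\mathbb D$ with $f(z)=z+\sum_{k\ge2}a_kz^k$. For $f\in\mathcal A$ with $f(z)\ne0$ for $z\in\mathbb D\setminus\{0\}$, set $U_f(z)=\left(\frac{z}{f(z)}\right)^2f'(z)-1$. $\mathcal U(1)$ is the class of such $f\in\mathcal A$ with $|U_f(z)|<1$ for all $z\in\mathbb D$. *)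

theory Defs
  imports "HOL-Complex_Analysis.Complex_Analysis"
begin

definition classA :: "(complex \<Rightarrow> complex) \<Rightarrow> bool" where
  "classA f \<longleftrightarrow> f holomorphic_on ball 0 1 \<and> f 0 = 0 \<and> deriv f 0 = 1"

text \<open>U_f(z) = (z/f(z))^2 f'(z) - 1; at z = 0 the value is the (removable) limit 0.\<close>
definition Uf :: "(complex \<Rightarrow> complex) \<Rightarrow> complex \<Rightarrow> complex" where
  "Uf f z = (if z = 0 then 0 else (z / f z)^2 * deriv f z - 1)"

definition classU1 :: "(complex \<Rightarrow> complex) \<Rightarrow> bool" where
  "classU1 f \<longleftrightarrow> classA f \<and> (\<forall>z\<in>ball 0 1. z \<noteq> 0 \<longrightarrow> f z \<noteq> 0)
     \<and> (\<forall>z\<in>ball 0 1. norm (Uf f z) < 1)"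

end

theory Submission
  imports Defs
begin

text \<open>
  Write \<open>z / f z = \<Sum> B n * z ^ n\<close> with \<open>B 0 = 1\<close>. Gronwall's area theorem for the univalent function \<open>1 / f\<close> says
  \<open>\<Sum> (n - 1) * |B n|\<^sup>2 \<le> 1\<close>. With \<open>\<phi> z = z / F z = \<Sum> B (2 * n) * z ^ n\<close> one has \<open>U_F = \<phi> - z * \<phi>' - 1\<close>, and
  Cauchy--Schwarz against the even part of the area sum bounds \<open>\<Sum> (n - 1) * |B (2 * n)| * r ^ n\<close> by
  the square root of \<open>\<Sum> (n - 1)\<^sup>2 / (2 * n - 1) * r ^ (2 * n)\<close>, whose value at \<open>r = r0\<close> is 1 by the equation for \<open>r0\<close>.
  That \<open>\<phi>\<close> has no zeros follows from \<open>2 * \<phi> (z\<^sup>2) = z / f z - z / f (- z)\<close> and the injectivity of \<open>f\<close>.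

  For the area theorem, an annulus \<open>\<rho> < |z| < r\<close> is mapped by \<open>1 / f\<close> into the region bounded by the image of
  \<open>|z| = \<rho>\<close>, which up to small errors is the ellipse \<open>1 / z + B 2 * z\<close>. The real-linear map
  \<open>w \<mapsto> w - k * cnj w\<close> with \<open>k = B 2 * \<rho>\<^sup>2\<close> turns this ellipse into a disc, whose area is compared with the
  integral of the Jacobian as \<open>\<rho>\<close> tends to 0.
\<close>

no_notation fps_nth (infixl "$" 75)

subsection \<open>Bessel's inequality on circles\<close>

text \<open>Cauchy's formula for the \<open>m\<close>-th derivative at 0, read on the circle as the
  extraction of a Fourier coefficient: multiplying by \<open>R ^ m / \<i>\<close> turns the kernel
  \<open>dz / z ^ Suc m\<close> into \<open>cnj (cis t ^ m) dt\<close>.\<close>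

lemma circle_coeff_integral:
  fixes A :: "complex \<Rightarrow> complex" and a :: "nat \<Rightarrow> complex"
  assumes sums: "\<And>z. norm z < 1 \<Longrightarrow> (\<lambda>n. a n * z ^ n) sums A z"
    and hol: "A holomorphic_on ball 0 1" and R: "0 < R" "R < 1"
  shows "((\<lambda>t. A (of_real R * cis t) * cnj (cis t ^ m)) has_integral of_real (2 * pi) * a m * of_real R ^ m) {0..2*pi}"
proof -
  have "A has_fps_expansion Abs_fps a"
  proof (rule has_fps_expansionI)
    have "eventually (\<lambda>u. u \<in> ball (0::complex) 1) (nhds 0)"
      by (intro eventually_nhds_in_open) auto
    then show "\<forall>\<^sub>F u in nhds 0. (\<lambda>n. fps_nth (Abs_fps a) n * u ^ n) sums A u"
      by eventually_elim (auto intro: sums)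
  qed
  then have am: "a m = (deriv ^^ m) A 0 / fact m"
    using fps_nth_fps_expansion by fastforce
  have "((\<lambda>u. A u / (u - 0) ^ Suc m) has_contour_integral
         (2 * pi * \<i> / fact m * (deriv ^^ m) A 0)) (circlepath 0 R)"
    using R by (intro Cauchy_has_contour_integral_higher_derivative_circlepath holomorphic_on_imp_continuous_on holomorphic_on_subset[OF hol]) auto
  then have *: "((\<lambda>t. A (R * cis t) / (R * cis t) ^ Suc m * R * \<i> * cis t) has_integral
         2 * pi * \<i> * a m) {0..2*pi}"
    by (simp add: circlepath_def has_contour_integral_part_circlepath_iff am)
  have "((\<lambda>t. (R^m / \<i>) * (A (R * cis t) / (R * cis t) ^ Suc m * R * \<i> * cis t)) has_integral
         (R^m / \<i>) * (2 * pi * \<i> * a m)) {0..2*pi}"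
    by (rule has_integral_mult_right[OF *])
  moreover have "(R^m / \<i>) * (A (R * cis t) / (R * cis t) ^ Suc m * R * \<i> * cis t)
      = A (of_real R * cis t) * cnj (cis t ^ m)" for t
  proof -
    have "cnj (cis t ^ m) = 1 / cis t ^ m"
      by (simp add: cis_cnj divide_inverse flip: cis_inverse power_inverse)
    moreover have "cis t \<noteq> 0" by simp
    ultimately show ?thesis using R by (simp add: field_simps power_mult_distrib)
  qed
  ultimately show ?thesis using R by (simp add: mult_ac)
qed

text \<open>The integral of \<open>|A - P|^2\<close> over the circle is nonnegative for the partial
  sum \<open>P\<close> of length \<open>N\<close>, and the pairings of \<open>A\<close> with
  \<open>P\<close> and of \<open>P\<close> with itself have the same value. With a finite
  \<open>P\<close> no infinite sum has to be exchanged with the integral.\<close>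

lemma bessel_circle:
  fixes A :: "complex \<Rightarrow> complex" and a :: "nat \<Rightarrow> complex"
  assumes sums: "\<And>z. norm z < 1 \<Longrightarrow> (\<lambda>n. a n * z ^ n) sums A z"
    and hol: "A holomorphic_on ball 0 1" and R: "0 < R" "R < 1"
  shows "2 * pi * (\<Sum>m<N. (norm (a m))\<^sup>2 * R ^ (2*m)) \<le>
     integral {0..2*pi} (\<lambda>t. (norm (A (of_real R * cis t)))\<^sup>2)"
proof -
  define P where "P = (\<lambda>z. \<Sum>m<N. a m * z ^ m)"
  define L where "L = (\<Sum>m<N. (norm (a m))\<^sup>2 * R ^ (2*m))"
  \<comment> \<open>Stated for a general \<open>B\<close> because it serves twice: for
    \<open>A\<close>, and for \<open>P\<close> seen as a power series with truncated
    coefficients.\<close>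
  have cross: "((\<lambda>t. B (of_real R * cis t) * cnj (P (of_real R * cis t))) has_integral
      (\<Sum>m<N. of_real (2 * pi) * b m * cnj (a m) * of_real R ^ (2*m))) {0..2*pi}"
    if "\<And>z. norm z < 1 \<Longrightarrow> (\<lambda>n. b n * z ^ n) sums B z" "B holomorphic_on ball 0 1" for B and b :: "nat \<Rightarrow> complex"
  proof -
    have "((\<lambda>t. \<Sum>m<N. (cnj (a m) * R ^ m) * (B (of_real R * cis t) * cnj (cis t ^ m))) has_integral
      (\<Sum>m<N. (cnj (a m) * R ^ m) * (of_real (2 * pi) * b m * of_real R ^ m))) {0..2*pi}"
      by (intro has_integral_sum finite_lessThan has_integral_mult_right circle_coeff_integral[where A = B and a = b] that R)
    then show ?thesis
      by (simp add: P_def sum_distrib_left mult_ac power_mult_distrib power_mult power2_eq_square)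
  qed
  have L: "of_real (2 * pi * L) = (\<Sum>m<N. of_real (2 * pi) * a m * cnj (a m) * of_real R ^ (2*m))"
    unfolding L_def of_real_mult of_real_sum sum_distrib_left complex_norm_square by (simp add: mult_ac)
  have AP: "((\<lambda>t. A (of_real R * cis t) * cnj (P (of_real R * cis t))) has_integral of_real (2*pi*L)) {0..2*pi}"
    unfolding L by (rule cross[OF sums hol])
  have PP: "((\<lambda>t. P (of_real R * cis t) * cnj (P (of_real R * cis t))) has_integral of_real (2*pi*L)) {0..2*pi}"
  proof -
    have "((\<lambda>t. P (of_real R * cis t) * cnj (P (of_real R * cis t))) has_integral
      (\<Sum>m<N. of_real (2 * pi) * (if m < N then a m else 0) * cnj (a m) * of_real R ^ (2*m))) {0..2*pi}"
    proof (rule cross)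
      show "(\<lambda>n. (if n < N then a n else 0) * z ^ n) sums P z" for z
        unfolding P_def using sums_If_finite_set[of "{..<N}" "\<lambda>n. a n * z ^ n"]
        by (simp add: if_distrib if_distribR cong: if_cong)
      show "P holomorphic_on ball 0 1"
        unfolding P_def by (intro holomorphic_intros)
    qed
    then show ?thesis unfolding L by simp
  qed
  have "(\<lambda>t. (norm (A (of_real R * cis t)))\<^sup>2) integrable_on {0..2*pi}"
    using R by (intro integrable_continuous_real continuous_intros
        continuous_on_compose2[OF holomorphic_on_imp_continuous_on[OF hol]]) (auto simp: norm_mult)
  then have "((\<lambda>t. (norm (A (of_real R * cis t)))\<^sup>2 - 2 * Re (A (of_real R * cis t) * cnj (P (of_real R * cis t)))
      + Re (P (of_real R * cis t) * cnj (P (of_real R * cis t)))) has_integral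
    integral {0..2*pi} (\<lambda>t. (norm (A (of_real R * cis t)))\<^sup>2) - 2 * Re (of_real (2*pi*L)) + Re (of_real (2*pi*L))) {0..2*pi}"
    by (intro has_integral_add has_integral_diff has_integral_mult_right has_integral_Re AP PP integrable_integral)
  then have "0 \<le> integral {0..2*pi} (\<lambda>t. (norm (A (of_real R * cis t)))\<^sup>2) - 2 * Re (of_real (2*pi*L)) + Re (of_real (2*pi*L))"
  proof (rule has_integral_nonneg)
    fix t
    have "(norm x)\<^sup>2 - 2 * Re (x * cnj y) + Re (y * cnj y) = (norm (x - y))\<^sup>2" for x y
      unfolding cmod_power2 by (simp add: power2_eq_square algebra_simps)
    then show "0 \<le> (norm (A (of_real R * cis t)))\<^sup>2 - 2 * Re (A (of_real R * cis t) * cnj (P (of_real R * cis t)))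
      + Re (P (of_real R * cis t) * cnj (P (of_real R * cis t)))" by simp
  qed
  then show ?thesis by (simp add: L_def)
qed

subsection \<open>Areas in logarithmic coordinates\<close>

lemma vec2_eq_iff: "x = y \<longleftrightarrow> x $ 1 = y $ 1 \<and> x $ 2 = y $ 2" for x y :: "'a ^ 2"
  unfolding vec_eq_iff forall_2 by (rule refl)

lemma mem_box_vec2: "x \<in> box u v \<longleftrightarrow> u $ 1 < x $ 1 \<and> x $ 1 < v $ 1 \<and> u $ 2 < x $ 2 \<and> x $ 2 < v $ 2"
  for x :: "real ^ 2"
  unfolding mem_box_cart forall_2 by argo

lemma mem_cbox_vec2: "x \<in> cbox u v \<longleftrightarrow> u $ 1 \<le> x $ 1 \<and> x $ 1 \<le> v $ 1 \<and> u $ 2 \<le> x $ 2 \<and> x $ 2 \<le> v $ 2"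
  for x :: "real ^ 2"
  unfolding mem_box_cart forall_2 by argo

text \<open>A bridge between two models of the plane: areas of images are computed by the Jacobian
  formula on \<open>real ^ 2\<close>, iterated integrals on \<open>real \<times> real\<close>. The
  identification of coordinates preserves the content of boxes, hence the scaling factor 1 in the
  proof.\<close>

lemma has_integral_vec2_pair:
  fixes f :: "real \<times> real \<Rightarrow> 'a::euclidean_space"
  assumes "(f has_integral i) (cbox (a1, a2) (b1, b2))"
  shows "((\<lambda>x::real^2. f (x $ 1, x $ 2)) has_integral i) (cbox (vector [a1, a2]) (vector [b1, b2]))"
proof -
  define G where "G = (\<lambda>x::real^2. (x $ 1, x $ 2))"
  define H where "H = (\<lambda>p::real\<times>real. vector [fst p, snd p] :: real^2)"
  have HG: "H (G x) = x" and GH: "G (H p) = p" for x p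
    by (auto simp: G_def H_def vec2_eq_iff)
  have G_mem: "G x \<in> cbox (u $ 1, u $ 2) (v $ 1, v $ 2) \<longleftrightarrow> x \<in> cbox u v" for x u v
    unfolding G_def mem_cbox_vec2 cbox_Pair_iff box_real atLeastAtMost_iff by argo
  have G: "G ` cbox u v = cbox (u $ 1, u $ 2) (v $ 1, v $ 2)" for u v
  proof (intro equalityI subsetI)
    fix p assume p: "p \<in> cbox (u $ 1, u $ 2) (v $ 1, v $ 2)"
    then have "H p \<in> cbox u v"
      by (simp add: GH flip: G_mem)
    then show "p \<in> G ` cbox u v" by (rule rev_image_eqI) (simp add: GH)
  qed (use G_mem in blast)
  have H: "H ` cbox (c1, c2) (d1, d2) = cbox (vector [c1, c2]) (vector [d1, d2])" for c1 c2 d1 d2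
  proof -
    have "cbox (c1, c2) (d1, d2) = G ` cbox (vector [c1, c2]) (vector [d1, d2])"
      by (simp add: G)
    then show ?thesis by (simp add: image_image HG)
  qed
  have "((\<lambda>x. f (G x)) has_integral (1 / 1) *\<^sub>R i) (H ` cbox (a1, a2) (b1, b2))"
  proof (rule has_integral_twiddle)
    show "continuous (at x) G" for x
      unfolding G_def by (intro continuous_intros continuous_component)
    show "\<exists>w z. G ` cbox u v = cbox w z" for u v using G by blast
    show "\<exists>w z. H ` cbox u v = cbox w z" for u v using H by (metis surj_pair)
    show "measure lborel (G ` cbox u v) = 1 * measure lborel (cbox u v)" for u v
    proof (cases "cbox u v = {}")
      case False
      then have "u $ 1 \<le> v $ 1" "u $ 2 \<le> v $ 2"
        by (auto simp: interval_ne_empty_cart)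
      then show ?thesis using False
        by (simp add: G content_Pair content_cbox_cart UNIV_2)
    qed simp
  qed (use HG GH assms in auto)
  then show ?thesis by (simp add: G_def H)
qed

text \<open>Under \<open>z = exp (s + \<i> * t)\<close> an open rectangle parametrizes the slit
  annulus, and \<open>g\<close> followed by \<open>w \<mapsto> w - k * cnj w\<close> is injective
  there. The left side integrates the Jacobian, so it is the area of the image, which lies in a disc
  of radius \<open>M\<close>.\<close>

lemma exp_rectangle_area:
  fixes g g' :: "complex \<Rightarrow> complex" and k :: complex
  assumes der: "\<And>z. z \<in> ball 0 1 - {0} \<Longrightarrow> (g has_field_derivative g' z) (at z)"
    and cont: "continuous_on (ball 0 1 - {0}) g'"
    and inj: "inj_on g (ball 0 1 - {0})"
    and k: "norm k < 1" and s: "s0 < s1" "s1 < 0"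
    and bound: "\<And>z. \<lbrakk>exp s0 < norm z; norm z < 1\<rbrakk> \<Longrightarrow> norm (g z - k * cnj (g z)) \<le> M"
  shows "(1 - (norm k)\<^sup>2) * integral {s0..s1} (\<lambda>s. integral {0..2*pi} (\<lambda>t. exp (2 * s) * (norm (g' (of_real (exp s) * cis t)))\<^sup>2))
     \<le> pi * M\<^sup>2"
proof -
  define J where "J = (\<lambda>w. vector [Re w, Im w] :: real^2)"
  define C where "C = (\<lambda>x::real^2. Complex (x $ 1) (x $ 2))"
  define L where "L = (\<lambda>w. w - k * cnj w)"
  define S where "S = box (vector [s0, 0] :: real^2) (vector [s1, 2*pi])"
  define H where "H = (\<lambda>x. J (L (g (exp (C x)))))"
  define H' where "H' = (\<lambda>x v. J (L (g' (exp (C x)) * (exp (C x) * C v))))"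
  define q where "q = (\<lambda>p::real\<times>real. (1 - (norm k)\<^sup>2) * (exp (2 * fst p) * (norm (g' (of_real (exp (fst p)) * cis (snd p))))\<^sup>2))"
  have expC: "exp (C x) = of_real (exp (x $ 1)) * cis (x $ 2)" for x
    by (simp add: C_def exp_eq_polar)
  have J: "bounded_linear J"
    by (rule linear_conv_bounded_linear[THEN iffD1], rule linearI) (auto simp: J_def vec2_eq_iff)
  have C: "bounded_linear C"
    by (rule linear_conv_bounded_linear[THEN iffD1], rule linearI) (auto simp: C_def complex_eq_iff)
  have L: "bounded_linear L"
    by (rule linear_conv_bounded_linear[THEN iffD1], rule linearI) (auto simp: L_def algebra_simps scaleR_conv_of_real)
  have dom: "exp s0 < norm (exp (C x)) \<and> norm (exp (C x)) < exp s1 \<and> norm (exp (C x)) < 1" if "x \<in> S" for x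
    using that s by (auto simp: S_def mem_box_vec2 C_def)
  have derH: "(H has_derivative H' x) (at x within S)" if "x \<in> S" for x
  proof -
    have "(g has_derivative (\<lambda>v. g' (exp (C x)) * v)) (at (exp (C x)))"
      using der[of "exp (C x)"] dom[OF that] by (auto simp: has_field_derivative_def)
    moreover have "((\<lambda>x. exp (C x)) has_derivative (\<lambda>v. exp (C x) * C v)) (at x within S)"
      by (rule has_derivative_compose[OF bounded_linear_imp_has_derivative[OF C] DERIV_exp[unfolded has_field_derivative_def]])
    ultimately have "((\<lambda>x. g (exp (C x))) has_derivative (\<lambda>v. g' (exp (C x)) * (exp (C x) * C v))) (at x within S)"
      by (rule has_derivative_compose[rotated])
    then show ?thesis unfolding H_def H'_def
      by (intro bounded_linear.has_derivative[OF J] bounded_linear.has_derivative[OF L])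
  qed
  have detH: "\<bar>det (matrix (H' x))\<bar> = q (x $ 1, x $ 2)" for x
  proof -
    \<comment> \<open>\<open>D\<close> is the complex derivative of \<open>g\<close> composed with
      \<open>exp\<close>, so the columns of the real derivative are the images \<open>L D\<close>
      and \<open>L (\<i> * D)\<close> of 1 and \<open>\<i>\<close>. Multiplication by
      \<open>D\<close> scales area by \<open>|D|^2\<close>, and \<open>L\<close> by
      \<open>1 - |k|^2\<close>.\<close>
    define D where "D = g' (exp (C x)) * exp (C x)"
    have "det (matrix (H' x)) = Re (L D) * Im (L (\<i> * D)) - Re (L (\<i> * D)) * Im (L D)"
    proof -
      have "C (axis 1 1) = 1" "C (axis 2 1) = \<i>" by (auto simp: C_def axis_def complex_eq_iff)
      then show ?thesis
        by (simp add: det_2 matrix_def H'_def J_def D_def mult_ac)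
    qed
    also have "\<dots> = (1 - (norm k)\<^sup>2) * (norm D)\<^sup>2"
      unfolding L_def cmod_power2 by (simp add: power2_eq_square algebra_simps)
    also have "\<dots> = q (x $ 1, x $ 2)"
      by (simp add: D_def q_def expC norm_mult power_mult_distrib exp_double[of "x $ 1"])
    finally have "det (matrix (H' x)) = q (x $ 1, x $ 2)" .
    moreover have "q (x $ 1, x $ 2) \<ge> 0"
      using k by (simp add: q_def power_le_one)
    ultimately show ?thesis by simp
  qed
  have injL: "inj L"
  proof (rule injI)
    fix v w assume "L v = L w"
    then have "v - w = k * cnj (v - w)" by (simp add: L_def algebra_simps)
    then have "norm (v - w) = norm k * norm (v - w)" by (metis complex_mod_cnj norm_mult)
    with k show "v = w" by auto
  qed
  have injH: "inj_on H S"
  proof (rule inj_onI)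
    fix x y assume xy: "x \<in> S" "y \<in> S" and "H x = H y"
    then have "L (g (exp (C x))) = L (g (exp (C y)))"
      by (auto simp: H_def J_def vec2_eq_iff complex_eq_iff)
    then have "exp (C x) = exp (C y)"
      using dom[OF xy(1)] dom[OF xy(2)] injL inj
      by (auto dest!: injD inj_onD)
    moreover have "\<bar>Im (C x) - Im (C y)\<bar> < 2 * pi"
      using xy by (auto simp: S_def mem_box_vec2 C_def)
    ultimately have "C x = C y" by (metis complex_eq_iff exp_complex_eqI)
    then show "x = y" by (auto simp: C_def vec2_eq_iff)
  qed
  have contq: "continuous_on (cbox (s0, 0) (s1, 2*pi)) q"
    unfolding q_def using s
    by (intro continuous_intros continuous_on_compose2[OF cont]) (auto simp: cbox_Pair_eq norm_mult)
  have "(q has_integral integral (cbox (s0, 0) (s1, 2*pi)) q) (cbox (s0, 0) (s1, 2*pi))"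
    by (intro integrable_integral integrable_continuous contq)
  then have "((\<lambda>x. q (x $ 1, x $ 2)) has_integral integral (cbox (s0, 0) (s1, 2*pi)) q) S"
    unfolding S_def has_integral_open_interval by (rule has_integral_vec2_pair)
  then have "H ` S \<in> lmeasurable \<and> measure lebesgue (H ` S) = integral (cbox (s0, 0) (s1, 2*pi)) q"
    using has_measure_differentiable_image[of S H H', OF _ derH injH] by (simp add: detH S_def)
  moreover have "H ` S \<subseteq> cball 0 M"
  proof clarify
    fix x assume "x \<in> S"
    then have "norm (L (g (exp (C x)))) \<le> M"
      using dom bound by (auto simp: L_def)
    moreover have "norm (J w) = norm w" for w
      by (simp add: J_def norm_vec_def L2_set_def UNIV_2 cmod_def)
    ultimately show "H x \<in> cball 0 M" by (simp add: H_def)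
  qed
  ultimately have "integral (cbox (s0, 0) (s1, 2*pi)) q \<le> measure lebesgue (cball (0::real^2) M)"
    by (metis measure_mono_fmeasurable lmeasurable_cball fmeasurableD)
  also have "\<dots> = pi * M\<^sup>2"
  proof -
    \<comment> \<open>Since \<open>s1 < 0\<close>, the exponent \<open>s1/2\<close> lies strictly
      between \<open>s0\<close> and 0, so \<open>bound\<close> applies at this point and forces
      \<open>M\<close> to be nonnegative.\<close>
    have "norm (g (of_real (exp (s1/2))) - k * cnj (g (of_real (exp (s1/2))))) \<le> M"
      using s by (intro bound) (auto)
    then have "M \<ge> 0" by (meson norm_ge_zero order_trans)
    then show ?thesis by (simp add: content_cball unit_ball_vol_2 measure_completion)
  qed
  also have "integral (cbox (s0, 0) (s1, 2*pi)) q = integral {s0..s1} (\<lambda>s. integral {0..2*pi} (\<lambda>t. q (s, t)))"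
    using integral_prod_continuous[OF contq] by simp
  also have "\<dots> = (1 - (norm k)\<^sup>2) * integral {s0..s1} (\<lambda>s. integral {0..2*pi} (\<lambda>t. exp (2 * s) * (norm (g' (of_real (exp s) * cis t)))\<^sup>2))"
    by (simp add: q_def)
  finally show ?thesis .
qed

subsection \<open>The area theorem\<close>

text \<open>
  If the conclusion fails, a line separates the value at \<open>z1\<close> from the image of the circle. Then the real part of
  \<open>1 / (a * (1 / f z - 1 / f z1))\<close> is negative on the circle, but this function is holomorphic inside
  and vanishes at 0.
\<close>
lemma reciprocal_univalent_omits:
  fixes f :: "complex \<Rightarrow> complex" and k c :: complex
  defines "L \<equiv> \<lambda>w. w - k * cnj w"
  assumes hol: "f holomorphic_on ball 0 1" and f0: "f 0 = 0" and inj: "inj_on f (ball 0 1)"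
    and rho: "0 < \<rho>" "\<rho> < norm z1" and z1: "norm z1 < 1"
    and bound: "\<And>z. norm z = \<rho> \<Longrightarrow> norm (L (1 / f z - c)) \<le> M"
  shows "norm (L (1 / f z1 - c)) \<le> M"
proof (rule ccontr)
  define v where "v = L (1 / f z1 - c)"
  \<comment> \<open>\<open>a\<close> is chosen so that
    \<open>Re (cnj v * (h - k * cnj h)) = Re (a * h)\<close> for all \<open>h\<close>.
    \<open>K\<close> is \<open>1 / (a * (1 / f z - 1 / f z1))\<close> with the fractions cleared,
    which makes it holomorphic at 0 as well.\<close>
  define a where "a = cnj v - v * cnj k"
  define K where "K = (\<lambda>z. f z1 * f z / (a * (f z1 - f z)))"
  assume "\<not> norm (L (1 / f z1 - c)) \<le> M"
  then have v: "norm v > M" by (simp add: v_def)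
  have fne: "f z1 \<noteq> f z" if "norm z < norm z1" for z
    using that inj_onD[OF inj, of z1 z] z1 by auto
  have fne0: "f z \<noteq> 0" if "z \<noteq> 0" "norm z < 1" for z
    using that inj_onD[OF inj, of z 0] f0 by auto
  have neg: "Re (a * (1 / f z - 1 / f z1)) < 0" if "norm z = \<rho>" for z
  proof -
    \<comment> \<open>The separating line passes through \<open>v\<close> perpendicularly to
      \<open>v\<close>: in that direction the image of the circle reaches at most
      \<open>norm v * M\<close>, which is less than \<open>(norm v)^2\<close>.\<close>
    have "Re (a * (1 / f z - 1 / f z1)) = Re (cnj v * (L (1 / f z - c) - v))"
    proof -
      have "L (1 / f z - c) - v = (1 / f z - 1 / f z1) - k * cnj (1 / f z - 1 / f z1)"
        by (simp add: v_def L_def algebra_simps)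
      moreover have "Re ((cnj v - v * cnj k) * h) = Re (cnj v * (h - k * cnj h))" for h
        by (simp add: algebra_simps)
      ultimately show ?thesis unfolding a_def by metis
    qed
    also have "\<dots> = Re (cnj v * L (1 / f z - c)) - (norm v)\<^sup>2"
      unfolding cmod_power2 by (simp add: power2_eq_square algebra_simps)
    also have "Re (cnj v * L (1 / f z - c)) \<le> norm (cnj v * L (1 / f z - c))"
      by (rule complex_Re_le_cmod)
    also have "\<dots> \<le> norm v * M"
      using bound[OF that] by (simp add: norm_mult mult_left_mono)
    also have "norm v * M - (norm v)\<^sup>2 < 0"
    proof -
      have "M \<ge> 0" using bound[OF that] norm_ge_zero order_trans by blast
      then have "norm v * M < norm v * norm v" using v by (intro mult_strict_left_mono) auto
      then show ?thesis by (simp add: power2_eq_square)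
    qed
    finally show ?thesis by simp
  qed
  have a: "a \<noteq> 0" using neg[of "of_real \<rho>"] rho by auto
  have hK: "K holomorphic_on ball 0 (norm z1)"
    unfolding K_def using z1 a fne
    by (intro holomorphic_intros holomorphic_on_subset[OF hol]) auto
  have negK: "Re (K z) < 0" if "norm z = \<rho>" for z
  proof -
    have "z \<noteq> 0" "z1 \<noteq> 0" using that rho by auto
    then have nz: "f z \<noteq> 0" "f z1 \<noteq> 0" "f z1 \<noteq> f z" using fne0 fne that rho z1 by auto
    have "K z = 1 / (a * (1 / f z - 1 / f z1))"
      using nz a by (simp add: K_def field_simps)
    moreover have "Re (1 / w) < 0" if "Re w < 0" for w
    proof -
      have "(Re w)\<^sup>2 + (Im w)\<^sup>2 > 0" using that by (simp add: sum_power2_gt_zero_iff)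
      with that show ?thesis by (simp add: Re_divide divide_neg_pos)
    qed
    ultimately show ?thesis using neg[OF that] by simp
  qed
  have contK: "continuous_on (cball 0 \<rho>) K"
    by (rule holomorphic_on_imp_continuous_on, rule holomorphic_on_subset[OF hK]) (use rho in auto)
  obtain x where x: "x \<in> sphere 0 \<rho>" "\<And>y. y \<in> sphere 0 \<rho> \<Longrightarrow> Re (K y) \<le> Re (K x)"
    using continuous_attains_sup[of "sphere 0 \<rho>" "\<lambda>z. Re (K z)"] rho
      continuous_on_Re[OF continuous_on_subset[OF contK sphere_cball]] by (auto simp: sphere_eq_empty)
  have "Re (K 0) \<le> Re (K x)"
    by (rule maximum_real_frontier[of K "cball 0 \<rho>"])
       (use x rho contK hK in \<open>auto intro: holomorphic_on_subset\<close>)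
  moreover have "K 0 = 0" by (simp add: K_def f0)
  ultimately show False using negK[of x] x by simp
qed

section \<open>Power series in the unit disc, and the area inequality from annuli to the full
  disc\<close>

lemma power_series_unit_disc:
  fixes a :: "nat \<Rightarrow> complex"
  assumes sums: "\<And>z. norm z < 1 \<Longrightarrow> (\<lambda>n. a n * z ^ n) sums p z" and z: "norm z < 1"
  shows "(p has_field_derivative deriv p z) (at z)"
    and "(\<lambda>n. of_nat n * a n * z ^ (n - 1)) sums deriv p z"
    and "summable (\<lambda>n. norm (a n * z ^ n))"
    and "p holomorphic_on ball 0 1"
proof -
  have *: "(p has_field_derivative deriv p w) (at w) \<and> (\<lambda>n. of_nat n * a n * w ^ (n - 1)) sums deriv p w
    \<and> summable (\<lambda>n. norm (a n * w ^ n))" if w: "norm w < 1" for w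
  proof -
    \<comment> \<open>Convergence at the real point \<open>r\<close> yields absolute convergence and
      termwise differentiation at every point of smaller modulus.\<close>
    obtain r where r: "norm w < r" "r < 1" using dense w by blast
    then have r0: "0 < r" using norm_ge_zero order_le_less_trans by blast
    have sm: "summable (\<lambda>n. a n * of_real r ^ n)"
      using sums[of "of_real r"] r r0 by (auto simp: sums_iff)
    then obtain g g' where g: "\<And>z. norm z < r \<Longrightarrow> (\<lambda>n. a n * z ^ n) sums g z \<and>
        (\<lambda>n. of_nat n * a n * z ^ (n - 1)) sums g' z \<and> (g has_field_derivative g' z) (at z)"
      using power_series_and_derivative_0[of a r] r0 by auto
    have "(p has_field_derivative g' w) (at w)"
    proof (rule has_field_derivative_transform_within_open[of g _ _ "ball 0 r"])
      show "g x = p x" if "x \<in> ball 0 r" for x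
        using g[of x] sums[of x] that r sums_unique2 by (force simp: dist_norm)
    qed (use g r in auto)
    moreover from this have "deriv p w = g' w" by (rule DERIV_imp_deriv)
    moreover have "summable (\<lambda>n. norm (a n * w ^ n))"
      using powser_insidea[OF sm] r r0 by simp
    ultimately show ?thesis using g[of w] r by simp
  qed
  show "(p has_field_derivative deriv p z) (at z)"
    and "(\<lambda>n. of_nat n * a n * z ^ (n - 1)) sums deriv p z"
    and "summable (\<lambda>n. norm (a n * z ^ n))" using *[OF z] by auto
  show "p holomorphic_on ball 0 1"
  proof (rule holomorphic_onI)
    fix x :: complex assume "x \<in> ball 0 1"
    then have "(p has_field_derivative deriv p x) (at x)" using * by simp
    then show "p field_differentiable at x within ball 0 1"
      using field_differentiable_at_within field_differentiable_def by blast
  qed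
qed

text \<open>The area bound for \<open>1 / f - c\<close> is combined with Bessel's inequality on each
  circle \<open>|z| = exp s\<close>. Integrating the squared coefficients over \<open>s\<close>
  gives the powers of \<open>r\<close> and \<open>\<rho>\<close>; the pole of \<open>1 / f\<close>
  contributes \<open>1 / \<rho>^2 - 1 / r^2\<close>.\<close>

lemma area_theorem_annulus:
  fixes f :: "complex \<Rightarrow> complex" and B :: "nat \<Rightarrow> complex"
  defines "p \<equiv> \<lambda>z. if z = 0 then 1 else z / f z"
  assumes hol: "f holomorphic_on ball 0 1" and f0: "f 0 = 0" and inj: "inj_on f (ball 0 1)"
    and sums: "\<And>z. norm z < 1 \<Longrightarrow> (\<lambda>n. B n * z ^ n) sums p z"
    and k: "norm k < 1" and rho: "0 < \<rho>" "\<rho> < r" "r < 1"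
    and bound: "\<And>z. norm z = \<rho> \<Longrightarrow> norm (1 / f z - c - k * cnj (1 / f z - c)) \<le> M"
  shows "(1 - (norm k)\<^sup>2) * (1 / \<rho>\<^sup>2 - 1 / r\<^sup>2 + (\<Sum>m<N. real m * (norm (B (Suc m)))\<^sup>2 * (r ^ (2*m) - \<rho> ^ (2*m)))) \<le> M\<^sup>2"
proof -
  \<comment> \<open>As \<open>1 / f z = p z / z\<close>, this is \<open>z^2\<close> times the
    derivative of \<open>1 / f\<close>; it extends holomorphically over 0 and has the coefficients
    \<open>a n\<close>.\<close>
  define A where "A = (\<lambda>z. z * deriv p z - p z)"
  define a where "a = (\<lambda>n. (of_nat n - 1) * B n)"
  define g' where "g' = (\<lambda>z. - deriv f z / (f z)\<^sup>2)"
  define s0 s1 where "s0 = ln \<rho>" and "s1 = ln r"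
  have s: "s0 < s1" "s1 < 0" and es: "exp s0 = \<rho>" "exp s1 = r" using rho by (auto simp: s0_def s1_def)
  note ps = power_series_unit_disc[OF sums]
  have fne0: "f z \<noteq> 0" if "z \<noteq> 0" "norm z < 1" for z
    using that inj_onD[OF inj, of z 0] f0 by auto
  have B0: "B 0 = 1" using sums_unique2[OF sums[of 0] powser_sums_zero] by (simp add: p_def)
  have derf: "(f has_field_derivative deriv f z) (at z)" if "norm z < 1" for z
    using hol that by (intro holomorphic_derivI[of _ "ball 0 1"]) auto
  have A_sums: "(\<lambda>n. a n * z ^ n) sums A z" if z: "norm z < 1" for z
  proof -
    have "(\<lambda>n. z * (of_nat n * B n * z ^ (n - 1)) - B n * z ^ n) sums A z"
      unfolding A_def by (intro sums_diff sums_mult ps(2) sums z)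
    moreover have "z * (of_nat n * B n * z ^ (n - 1)) - B n * z ^ n = a n * z ^ n" for n
      by (cases n) (auto simp: a_def algebra_simps)
    ultimately show ?thesis by simp
  qed
  have A_hol: "A holomorphic_on ball 0 1" by (rule power_series_unit_disc(4)[OF A_sums, of 0]) auto
  have A_eq: "g' z = A z / z\<^sup>2" if "z \<noteq> 0" "norm z < 1" for z
  proof -
    have "((\<lambda>w. w / f w) has_field_derivative (1 * f z - z * deriv f z) / (f z * f z)) (at z)"
      using fne0 that by (intro derivative_intros derf) auto
    then have "(p has_field_derivative (1 * f z - z * deriv f z) / (f z * f z)) (at z)"
      by (rule has_field_derivative_transform_within_open[of _ _ _ "- {0}"]) (use that in \<open>auto simp: p_def\<close>)
    then have "deriv p z = (f z - z * deriv f z) / (f z * f z)" by (simp add: DERIV_imp_deriv)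
    moreover have "p z = z / f z" using that by (simp add: p_def)
    ultimately have "A z = z * ((f z - z * deriv f z) / (f z * f z)) - z / f z" by (simp add: A_def)
    then show ?thesis using fne0[OF that] that
      by (simp add: g'_def field_simps power2_eq_square)
  qed
  have main: "(1 - (norm k)\<^sup>2) * integral {s0..s1} (\<lambda>s. integral {0..2*pi} (\<lambda>t. exp (2 * s) * (norm (g' (of_real (exp s) * cis t)))\<^sup>2))
     \<le> pi * M\<^sup>2"
  proof (rule exp_rectangle_area[where g = "\<lambda>z. 1 / f z - c"])
    show "((\<lambda>z. 1 / f z - c) has_field_derivative g' z) (at z)" if "z \<in> ball 0 1 - {0}" for z
      using that fne0 unfolding g'_def
      by (auto intro!: derivative_eq_intros derf simp: power2_eq_square)
    show "continuous_on (ball 0 1 - {0}) g'"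
      unfolding g'_def using fne0
      by (intro continuous_intros holomorphic_on_imp_continuous_on holomorphic_intros holomorphic_on_subset[OF hol]) auto
    show "inj_on (\<lambda>z. 1 / f z - c) (ball 0 1 - {0})"
      using inj by (auto simp: inj_on_def)
    \<comment> \<open>The bound is assumed only on the circle \<open>|z| = \<rho>\<close>; the
      omission lemma carries it to all larger moduli.\<close>
    show "norm (1 / f z - c - k * cnj (1 / f z - c)) \<le> M" if "exp s0 < norm z" "norm z < 1" for z
      using reciprocal_univalent_omits[OF hol f0 inj _ _ _ bound] that rho es by auto
  qed (use k s in auto)
  have cont: "continuous_on ({s0..s1} \<times> {0..2*pi}) (\<lambda>(s, t). exp (2 * s) * (norm (g' (of_real (exp s) * cis t)))\<^sup>2)"
  proof -
    have "continuous_on (ball 0 1 - {0}) g'"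
      unfolding g'_def using fne0
      by (intro continuous_intros holomorphic_on_imp_continuous_on holomorphic_intros holomorphic_on_subset[OF hol]) auto
    moreover have "continuous_on ({s0..s1} \<times> {0..2*pi}) (\<lambda>x. of_real (exp (fst x)) * cis (snd x))"
      by (intro continuous_intros)
    moreover have "(\<lambda>x. of_real (exp (fst x)) * cis (snd x)) ` ({s0..s1} \<times> {0..2*pi}) \<subseteq> ball 0 1 - {0}"
      using s by (auto simp: norm_mult)
    ultimately have "continuous_on ({s0..s1} \<times> {0..2*pi}) (\<lambda>x. g' (of_real (exp (fst x)) * cis (snd x)))"
      by (rule continuous_on_compose2)
    then show ?thesis unfolding split_beta
      by (intro continuous_on_mult continuous_on_power continuous_on_norm continuous_on_exp continuous_on_const continuous_on_fst continuous_on_id)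
  qed
  define J where "J = (\<lambda>s. integral {0..2*pi} (\<lambda>t. exp (2 * s) * (norm (g' (of_real (exp s) * cis t)))\<^sup>2))"
  have J_int: "J integrable_on {s0..s1}"
    unfolding J_def using integral_continuous_on_param[of "{s0..s1}" 0 "2*pi", unfolded box_real, OF cont]
    by (rule integrable_continuous_real)
  \<comment> \<open>The square of \<open>real m - 1\<close> is split so that one factor stays with
    the exponential. Its antiderivative is then \<open>exp (2 * (real m - 1) * s) / 2\<close>, with
    no division by \<open>real m - 1\<close>, which is 0 for \<open>m = 1\<close>.\<close>
  define T where "T = (\<lambda>s. \<Sum>m<Suc N. 2 * pi * (real m - 1) * (norm (B m))\<^sup>2 * ((real m - 1) * exp (2 * (real m - 1) * s)))"
  have T_int: "(T has_integral (\<Sum>m<Suc N. 2 * pi * (real m - 1) * (norm (B m))\<^sup>2 *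
      (exp (2 * (real m - 1) * s1) / 2 - exp (2 * (real m - 1) * s0) / 2))) {s0..s1}"
    unfolding T_def
  proof (intro has_integral_sum finite_lessThan has_integral_mult_right fundamental_theorem_of_calculus)
    fix m x
    show "((\<lambda>s. exp (2 * (real m - 1) * s) / 2) has_vector_derivative (real m - 1) * exp (2 * (real m - 1) * x)) (at x within {s0..s1})"
      unfolding has_real_derivative_iff_has_vector_derivative[symmetric]
      by (auto intro!: derivative_eq_intros)
  qed (use s in auto)
  have TJ: "T s \<le> J s" if "s \<in> {s0..s1}" for s
  proof -
    have R: "0 < exp s" "exp s < 1" using that s by auto
    have "T s = exp (- 2 * s) * (2 * pi * (\<Sum>m<Suc N. (norm (a m))\<^sup>2 * exp s ^ (2*m)))"
      unfolding T_def sum_distrib_left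
    proof (rule sum.cong[OF refl])
      fix m
      have "exp (2 * (real m - 1) * s) = exp (- 2 * s) * exp s ^ (2*m)"
        by (simp add: exp_of_nat_mult[symmetric] exp_add[symmetric] algebra_simps)
      moreover have "norm (a m) = \<bar>real m - 1\<bar> * norm (B m)"
        by (simp add: a_def norm_mult) (metis norm_of_real of_real_1 of_real_diff of_real_of_nat_eq real_norm_def)
      ultimately show "2 * pi * (real m - 1) * (norm (B m))\<^sup>2 * ((real m - 1) * exp (2 * (real m - 1) * s))
          = exp (- 2 * s) * (2 * pi * ((norm (a m))\<^sup>2 * exp s ^ (2*m)))"
        by (simp add: power_mult_distrib power2_eq_square[of "real m - 1"])
    qed
    also have "\<dots> \<le> exp (- 2 * s) * integral {0..2*pi} (\<lambda>t. (norm (A (of_real (exp s) * cis t)))\<^sup>2)"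
      by (intro mult_left_mono bessel_circle[OF A_sums A_hol R]) auto
    also have "\<dots> = integral {0..2*pi} (\<lambda>t. exp (- 2 * s) * (norm (A (of_real (exp s) * cis t)))\<^sup>2)"
      by simp
    also have "\<dots> = J s"
    proof -
      have "exp (- 2 * s) * (norm (A (of_real (exp s) * cis t)))\<^sup>2 = exp (2 * s) * (norm (g' (of_real (exp s) * cis t)))\<^sup>2" for t
      proof -
        have "exp (- 2 * s) = exp (2 * s) / exp s ^ 4"
          by (simp add: exp_of_nat_mult[symmetric] exp_diff[symmetric])
        then show ?thesis using R
          by (subst A_eq) (auto simp: norm_mult norm_divide norm_power power_divide power_mult_distrib)
      qed
      then show ?thesis by (simp add: J_def)
    qed
    finally show ?thesis .
  qed
  have "pi * (1 / \<rho>\<^sup>2 - 1 / r\<^sup>2 + (\<Sum>m<N. real m * (norm (B (Suc m)))\<^sup>2 * (r ^ (2*m) - \<rho> ^ (2*m))))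
     = (\<Sum>m<Suc N. 2 * pi * (real m - 1) * (norm (B m))\<^sup>2 *
      (exp (2 * (real m - 1) * s1) / 2 - exp (2 * (real m - 1) * s0) / 2))"
  proof -
    have e: "exp (2 * real m * s0) = \<rho> ^ (2*m)" "exp (2 * real m * s1) = r ^ (2*m)" for m
      using exp_of_nat_mult[of "2*m" s0] exp_of_nat_mult[of "2*m" s1] by (auto simp: es)
    \<comment> \<open>The term \<open>m = 0\<close>, with exponent -2 and \<open>B 0 = 1\<close>,
      gives the two reciprocal squares; shifting the remaining terms by one produces
      \<open>B (Suc m)\<close>.\<close>
    have "exp (2 * (real 0 - 1) * s0) = 1 / \<rho>\<^sup>2" "exp (2 * (real 0 - 1) * s1) = 1 / r\<^sup>2"
      using e[of 1] by (auto simp: exp_minus divide_inverse)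
    moreover have "real (Suc m) - 1 = real m" for m by simp
    ultimately show ?thesis
      unfolding sum.lessThan_Suc_shift by (simp only: e) (simp add: B0 sum_distrib_left algebra_simps)
  qed
  also have "\<dots> \<le> integral {s0..s1} J"
    using has_integral_le[OF T_int integrable_integral[OF J_int] TJ] .
  finally have "(1 - (norm k)\<^sup>2) * (pi * (1 / \<rho>\<^sup>2 - 1 / r\<^sup>2 + (\<Sum>m<N. real m * (norm (B (Suc m)))\<^sup>2 * (r ^ (2*m) - \<rho> ^ (2*m)))))
     \<le> (1 - (norm k)\<^sup>2) * integral {s0..s1} J"
    using k by (intro mult_left_mono) (auto simp: power_le_one)
  also have "\<dots> \<le> pi * M\<^sup>2" using main unfolding J_def .
  finally have "pi * ((1 - (norm k)\<^sup>2) * (1 / \<rho>\<^sup>2 - 1 / r\<^sup>2 + (\<Sum>m<N. real m * (norm (B (Suc m)))\<^sup>2 * (r ^ (2*m) - \<rho> ^ (2*m)))))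
     \<le> pi * M\<^sup>2" by (simp only: mult.left_commute)
  then show ?thesis by simp
qed

text \<open>Here \<open>u\<close> stands for \<open>1 / f z\<close>, so
  \<open>u - B 1 = 1 / z + B 2 * z + e\<close> with a remainder \<open>e\<close> of order
  \<open>\<rho>^2\<close>. On the circle, this choice of \<open>k\<close> cancels the linear term
  and leaves \<open>(1 - |k|^2) / z\<close>; the factor 2 accounts for \<open>e\<close> and
  \<open>k * cnj e\<close>.\<close>

lemma reciprocal_linear_bound:
  fixes B :: "nat \<Rightarrow> complex"
  assumes p: "(\<lambda>n. B n * z ^ n) sums (z * u)" and B0: "B 0 = 1"
    and sm: "summable (\<lambda>n. norm (B (n + 3)) * (1/2) ^ n)"
    and z: "norm z = \<rho>" "0 < \<rho>" "\<rho> \<le> 1/2"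
    and k: "k = B 2 * of_real (\<rho>\<^sup>2)" "norm k \<le> 1"
  shows "norm (u - B 1 - k * cnj (u - B 1))
    \<le> (1 - (norm k)\<^sup>2) / \<rho> + 2 * (\<Sum>n. norm (B (n + 3)) * (1/2) ^ n) * \<rho>\<^sup>2"
proof -
  define C where "C = (\<Sum>n. norm (B (n + 3)) * (1/2) ^ n)"
  define E where "E = (\<Sum>n. B (n + 3) * z ^ (n + 3))"
  define e where "e = E / z"
  have z0: "z \<noteq> 0" using z by auto
  have "norm E \<le> (\<Sum>n. \<rho> ^ 3 * (norm (B (n + 3)) * (1/2) ^ n))"
    unfolding E_def
  proof (rule norm_suminf_le)
    fix n
    have "norm (B (n + 3) * z ^ (n + 3)) = \<rho> ^ 3 * (norm (B (n + 3)) * \<rho> ^ n)"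
      by (simp add: norm_mult norm_power z power_add)
    also have "\<dots> \<le> \<rho> ^ 3 * (norm (B (n + 3)) * (1/2) ^ n)"
      using z by (intro mult_left_mono power_mono) auto
    finally show "norm (B (n + 3) * z ^ (n + 3)) \<le> \<rho> ^ 3 * (norm (B (n + 3)) * (1/2) ^ n)" .
  qed (intro summable_mult sm)
  also have "\<dots> = \<rho> ^ 3 * C" unfolding C_def by (rule suminf_mult[OF sm])
  finally have e: "norm e \<le> C * \<rho>\<^sup>2"
    using z by (simp add: e_def norm_divide field_simps power2_eq_square power3_eq_cube)
  have "z * u = (\<Sum>n<3. B n * z ^ n) + E"
    using suminf_split_initial_segment[of "\<lambda>n. B n * z ^ n" 3] p by (simp add: E_def sums_iff)
  then have "z * u = 1 + B 1 * z + B 2 * z\<^sup>2 + E"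
    by (simp add: numeral_3_eq_3 B0 numeral_2_eq_2)
  then have "z * (u - B 1) = z * (1 / z + B 2 * z + e)"
    using z0 by (simp add: e_def field_simps power2_eq_square)
  then have u: "u - B 1 = 1 / z + B 2 * z + e" using z0 by (metis mult_left_cancel)
  \<comment> \<open>Writing \<open>\<rho>^2\<close> as \<open>z * cnj z\<close> gives
    \<open>k * cnj (1 / z) = B 2 * z\<close>, which is the cancellation.\<close>
  have k': "k = B 2 * (z * cnj z)"
    using z by (simp add: k flip: complex_norm_square)
  have nk: "of_real ((norm k)\<^sup>2) = k * cnj k" by (rule complex_norm_square)
  have "u - B 1 - k * cnj (u - B 1) = of_real (1 - (norm k)\<^sup>2) / z + (e - k * cnj e)"
    unfolding of_real_diff nk u using z0 by (simp add: k' field_simps)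
  also have "norm \<dots> \<le> norm (of_real (1 - (norm k)\<^sup>2) / z) + (norm e + norm (k * cnj e))"
    by (intro norm_triangle_le add_left_mono norm_triangle_ineq4)
  also have "norm (of_real (1 - (norm k)\<^sup>2) / z) = (1 - (norm k)\<^sup>2) / \<rho>"
    using k(2) z unfolding norm_divide norm_of_real by (simp add: power_le_one)
  also have "norm (k * cnj e) \<le> norm e"
    using k(2) by (simp add: norm_mult mult_left_le_one_le)
  finally show ?thesis using e by (simp add: C_def)
qed

text \<open>Both sides of the annulus inequality blow up like \<open>1 / \<rho>^2\<close>. Because
  the circle's image is corrected to a disc of radius \<open>(1 - |k|^2) / \<rho>\<close> up to
  order \<open>\<rho>^2\<close>, these terms cancel and the error vanishes as \<open>\<rho>\<close>
  tends to 0; then \<open>r\<close> tends to 1.\<close>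

lemma area_theorem:
  fixes f :: "complex \<Rightarrow> complex" and B :: "nat \<Rightarrow> complex"
  assumes hol: "f holomorphic_on ball 0 1" and f0: "f 0 = 0" and inj: "inj_on f (ball 0 1)"
    and sums: "\<And>z. norm z < 1 \<Longrightarrow> (\<lambda>n. B n * z ^ n) sums (if z = 0 then 1 else z / f z)"
  shows "(\<Sum>m<N. real m * (norm (B (Suc m)))\<^sup>2) \<le> 1"
proof -
  define C where "C = (\<Sum>n. norm (B (n + 3)) * (1/2) ^ n)"
  define x where "x = (\<lambda>m. (norm (B (Suc m)))\<^sup>2)"
  define D where "D = norm (B 2)"
  have B0: "B 0 = 1" using sums_unique2[OF sums[of 0] powser_sums_zero] by simp
  have sm: "summable (\<lambda>n. norm (B (n + 3)) * (1/2) ^ n)"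
  proof -
    have "summable (\<lambda>n. norm (B n * (1/2) ^ n))"
      by (rule power_series_unit_disc(3)[OF sums]) (auto simp: norm_divide)
    then have "summable (\<lambda>n. norm (B (n + 3) * (1/2) ^ (n + 3)))"
      by (subst summable_iff_shift)
    then have "summable (\<lambda>n. 8 * norm (B (n + 3) * (1/2) ^ (n + 3)))" by (rule summable_mult)
    moreover have "8 * norm (B (n + 3) * (1/2) ^ (n + 3)) = norm (B (n + 3)) * (1/2) ^ n" for n
      by (simp add: norm_mult norm_power norm_divide power_add power3_eq_cube)
    ultimately show ?thesis by simp
  qed
  \<comment> \<open>The restriction \<open>\<rho> < 1/2\<close> makes the tail constant
    \<open>C\<close> applicable, and \<open>\<rho> < 1 / (D + 1)\<close> gives
    \<open>D * \<rho> < 1\<close>, hence \<open>norm k < 1\<close>.\<close>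
  have step: "(\<Sum>m<N. real m * x m * (r ^ (2*m) - \<rho> ^ (2*m))) \<le> 1 / r\<^sup>2 + 4 * C * \<rho> + 4 * C\<^sup>2 * \<rho> ^ 4 / (1 - D\<^sup>2 * \<rho> ^ 4)"
    if \<rho>: "0 < \<rho>" "\<rho> < r" "r < 1" "\<rho> < 1/2" "\<rho> < 1 / (D + 1)" for \<rho> r
  proof -
    define k where "k = B 2 * of_real (\<rho>\<^sup>2)"
    define q where "q = 1 - (norm k)\<^sup>2"
    have nk: "norm k = D * \<rho>\<^sup>2" by (simp add: k_def D_def norm_mult norm_power)
    have D: "D \<ge> 0" by (simp add: D_def)
    have "D * \<rho> < 1" using \<rho> D by (simp add: field_simps)
    moreover have "D * \<rho>\<^sup>2 \<le> D * \<rho>"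
      using \<rho> D by (intro mult_left_mono) (auto simp: power2_eq_square)
    ultimately have k: "norm k < 1" using nk by simp
    have "(norm k)\<^sup>2 < 1" using k by (simp add: abs_square_less_1)
    moreover have nk2: "(norm k)\<^sup>2 = D\<^sup>2 * \<rho> ^ 4" by (simp add: nk power_mult_distrib)
    ultimately have q: "0 < q" "q \<le> 1" "q = 1 - D\<^sup>2 * \<rho> ^ 4" by (auto simp: q_def)
    have "q * (1 / \<rho>\<^sup>2 - 1 / r\<^sup>2 + (\<Sum>m<N. real m * (norm (B (Suc m)))\<^sup>2 * (r ^ (2*m) - \<rho> ^ (2*m)))) \<le> (q / \<rho> + 2 * C * \<rho>\<^sup>2)\<^sup>2"
      unfolding q_def
    proof (rule area_theorem_annulus[OF hol f0 inj sums k \<rho>(1-3)])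
      fix z :: complex assume z: "norm z = \<rho>"
      then have "z \<noteq> 0" "norm z < 1" using \<rho> by auto
      then have "(\<lambda>n. B n * z ^ n) sums (z * (1 / f z))" using sums[of z] by simp
      from reciprocal_linear_bound[OF this B0 sm z _ _ k_def] 
      show "norm (1 / f z - B 1 - k * cnj (1 / f z - B 1)) \<le> (1 - (norm k)\<^sup>2) / \<rho> + 2 * C * \<rho>\<^sup>2"
        using \<rho> k by (simp add: C_def)
    qed
    \<comment> \<open>A factor \<open>q\<close> is split off to cancel the Jacobian factor; what
      remains of the leading term, \<open>q / \<rho>^2\<close>, is at most
      \<open>1 / \<rho>^2\<close>.\<close>
    also have "(q / \<rho> + 2 * C * \<rho>\<^sup>2)\<^sup>2 = q * (q / \<rho>\<^sup>2 + 4 * C * \<rho> + 4 * C\<^sup>2 * \<rho> ^ 4 / q)"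
      using q \<rho> by (simp add: field_simps power2_eq_square power4_eq_xxxx)
    finally have "1 / \<rho>\<^sup>2 - 1 / r\<^sup>2 + (\<Sum>m<N. real m * x m * (r ^ (2*m) - \<rho> ^ (2*m))) \<le> q / \<rho>\<^sup>2 + 4 * C * \<rho> + 4 * C\<^sup>2 * \<rho> ^ 4 / q"
      using q by (simp add: x_def)
    moreover have "q / \<rho>\<^sup>2 \<le> 1 / \<rho>\<^sup>2" using q by (simp add: divide_right_mono)
    ultimately show ?thesis unfolding q(3) by linarith
  qed
  have r_bound: "(\<Sum>m<N. real m * x m * r ^ (2*m)) \<le> 1 / r\<^sup>2" if r: "0 < r" "r < 1" for r
  proof (rule tendsto_le[OF trivial_limit_at_right_real])
    show "((\<lambda>\<rho>. 1 / r\<^sup>2 + 4 * C * \<rho> + 4 * C\<^sup>2 * \<rho> ^ 4 / (1 - D\<^sup>2 * \<rho> ^ 4)) \<longlongrightarrow> 1 / r\<^sup>2) (at_right 0)"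
      by (auto intro!: tendsto_eq_intros)
    show "((\<lambda>\<rho>. \<Sum>m<N. real m * x m * (r ^ (2*m) - \<rho> ^ (2*m))) \<longlongrightarrow> (\<Sum>m<N. real m * x m * r ^ (2*m))) (at_right 0)"
    proof (rule tendsto_sum)
      fix m
      \<comment> \<open>At \<open>m = 0\<close> the power \<open>0 ^ (2*m)\<close> is 1, but the
        factor \<open>real m\<close> removes that term.\<close>
      have "((\<lambda>\<rho>. real m * x m * (r ^ (2*m) - \<rho> ^ (2*m))) \<longlongrightarrow> real m * x m * (r ^ (2*m) - 0 ^ (2*m))) (at_right 0)"
        by (intro tendsto_intros)
      then show "((\<lambda>\<rho>. real m * x m * (r ^ (2*m) - \<rho> ^ (2*m))) \<longlongrightarrow> real m * x m * r ^ (2*m)) (at_right 0)"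
        by (cases m) auto
    qed
    define b where "b = min (min r (1/2)) (1 / (D + 1))"
    have "D \<ge> 0" by (simp add: D_def)
    then have "0 < b" using r by (simp add: b_def)
    then have "eventually (\<lambda>\<rho>. \<rho> \<in> {0<..<b}) (at_right 0)" by (rule eventually_at_right_real)
    then show "\<forall>\<^sub>F \<rho> in at_right 0. (\<Sum>m<N. real m * x m * (r ^ (2*m) - \<rho> ^ (2*m)))
       \<le> 1 / r\<^sup>2 + 4 * C * \<rho> + 4 * C\<^sup>2 * \<rho> ^ 4 / (1 - D\<^sup>2 * \<rho> ^ 4)"
      by eventually_elim (rule step, use r in \<open>auto simp: b_def\<close>)
  qed
  have "(\<Sum>m<N. real m * x m) \<le> 1"
  proof (rule tendsto_le[OF trivial_limit_at_left_real])
    show "((\<lambda>r::real. 1 / r\<^sup>2) \<longlongrightarrow> 1) (at_left 1)" by (auto intro!: tendsto_eq_intros)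
    show "((\<lambda>r. \<Sum>m<N. real m * x m * r ^ (2*m)) \<longlongrightarrow> (\<Sum>m<N. real m * x m)) (at_left 1)"
      by (rule tendsto_eq_intros refl | simp)+
    have "eventually (\<lambda>r::real. r \<in> {0<..<1}) (at_left 1)" by (rule eventually_at_left_real) simp
    then show "\<forall>\<^sub>F r in at_left 1. (\<Sum>m<N. real m * x m * r ^ (2*m)) \<le> 1 / r\<^sup>2"
      by eventually_elim (use r_bound in auto)
  qed
  then show ?thesis by (simp add: x_def)
qed

subsection \<open>The radius of univalence\<close>

text \<open>From \<open>4 * k^2 = (2*k+1)^2 - 2 * (2*k+1) + 1\<close> the weight
  \<open>k^2 / (2*k+1)\<close> equals \<open>((2*k+1) - 2 + 1 / (2*k+1)) / 4\<close>. The three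
  pieces are a differentiated geometric series, a geometric series and a logarithmic series.\<close>

lemma even_coeffs_majorant_sums:
  fixes r :: real
  assumes r: "0 < r" "r < 1"
  shows "(\<lambda>k. (real k)\<^sup>2 / (2 * real k + 1) * r ^ (2*k + 2)) sums
    ((r\<^sup>2 * (2 / (1 - r\<^sup>2)\<^sup>2 - 1 / (1 - r\<^sup>2)) - 2 * (r\<^sup>2 / (1 - r\<^sup>2)) + r / 2 * ln ((1 + r) / (1 - r))) / 4)"
proof -
  have x: "norm (r\<^sup>2) < 1" using r by (simp add: abs_square_less_1)
  have g: "(\<lambda>k. r\<^sup>2 * (r\<^sup>2) ^ k) sums (r\<^sup>2 / (1 - r\<^sup>2))"
    using sums_mult[OF geometric_sums[OF x], of "r\<^sup>2"] by simp
  have d: "(\<lambda>k. r\<^sup>2 * (2 * (of_nat (Suc k) * (r\<^sup>2) ^ k) - (r\<^sup>2) ^ k)) sums (r\<^sup>2 * (2 / (1 - r\<^sup>2)\<^sup>2 - 1 / (1 - r\<^sup>2)))"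
    using sums_mult[OF sums_diff[OF sums_mult[OF geometric_deriv_sums[OF x], of 2] geometric_sums[OF x]], of "r\<^sup>2"] by simp
  \<comment> \<open>The logarithmic series at \<open>x\<close> runs in powers of
    \<open>(x - 1) / (x + 1)\<close>; this \<open>x\<close> makes that quotient
    \<open>r\<close>.\<close>
  have "((1 + r) / (1 - r) - 1) / ((1 + r) / (1 - r) + 1) = r" using r by (simp add: field_simps)
  then have l: "(\<lambda>k. r / 2 * (2 * r ^ (2*k+1) / of_nat (2*k+1))) sums (r / 2 * ln ((1 + r) / (1 - r)))"
    using ln_series_quadratic[of "(1 + r) / (1 - r)"] r by (intro sums_mult) simp
  have "(\<lambda>k. (r\<^sup>2 * (2 * (of_nat (Suc k) * (r\<^sup>2) ^ k) - (r\<^sup>2) ^ k) - 2 * (r\<^sup>2 * (r\<^sup>2) ^ k)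
      + r / 2 * (2 * r ^ (2*k+1) / of_nat (2*k+1))) / 4) sums
    ((r\<^sup>2 * (2 / (1 - r\<^sup>2)\<^sup>2 - 1 / (1 - r\<^sup>2)) - 2 * (r\<^sup>2 / (1 - r\<^sup>2)) + r / 2 * ln ((1 + r) / (1 - r))) / 4)"
    by (intro sums_divide sums_add sums_diff sums_mult[of _ _ 2] g d l)
  moreover have "(r\<^sup>2 * (2 * (of_nat (Suc k) * (r\<^sup>2) ^ k) - (r\<^sup>2) ^ k) - 2 * (r\<^sup>2 * (r\<^sup>2) ^ k)
      + r / 2 * (2 * r ^ (2*k+1) / of_nat (2*k+1))) / 4 = (real k)\<^sup>2 / (2 * real k + 1) * r ^ (2*k + 2)" for k
  proof -
    have "(r\<^sup>2) ^ k = r ^ (2*k)" by (simp add: power_mult)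
    moreover have "2 * real k + 1 \<noteq> 0" by linarith
    ultimately show ?thesis
      by (simp add: field_simps power2_eq_square)
  qed
  ultimately show ?thesis by (simp only:)
qed

text \<open>Cauchy--Schwarz with the factor \<open>sqrt (2 * real k + 1)\<close> moved onto
  \<open>y k\<close>: one sum is the area sum, the other is the majorant series, whose total is
  exactly 1 by the equation for \<open>r\<close>.\<close>

lemma weighted_sum_le_one:
  fixes y :: "nat \<Rightarrow> real"
  assumes y: "\<And>k. y k \<ge> 0" and area: "\<And>N. (\<Sum>k<N. (2 * real k + 1) * (y k)\<^sup>2) \<le> 1"
    and r: "0 < r" "r < 1"
    and root: "r * (1 - r\<^sup>2)\<^sup>2 / 2 * ln ((1 + r) / (1 - r)) - (4 + r ^ 4 - 7 * r\<^sup>2) = 0"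
  shows "summable (\<lambda>k. real k * y k * r ^ Suc k)" and "(\<Sum>k. real k * y k * r ^ Suc k) \<le> 1"
proof -
  define L where "L = ln ((1 + r) / (1 - r))"
  define w where "w = (\<lambda>k. (real k)\<^sup>2 / (2 * real k + 1) * r ^ (2*k + 2))"
  have "1 - r\<^sup>2 > 0" using r by (simp add: abs_square_less_1 power_less_one_iff)
  \<comment> \<open>With \<open>q = 1 - r^2\<close> one has
    \<open>4 * q^2 - r^2 * (2 - 3 * q) = 4 + r^4 - 7 * r^2\<close>, so the root equation is the
    statement that the majorant sums to 1, cleared of denominators.\<close>
  moreover have "r / 2 * L * (1 - r\<^sup>2)\<^sup>2 = 4 + r ^ 4 - 7 * r\<^sup>2"
    using root by (simp add: L_def field_simps)
  then have "r\<^sup>2 * (2 - 3 * (1 - r\<^sup>2)) + r / 2 * L * (1 - r\<^sup>2)\<^sup>2 = 4 * (1 - r\<^sup>2)\<^sup>2"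
    by (simp add: power2_eq_square power4_eq_xxxx algebra_simps)
  ultimately have "(r\<^sup>2 * (2 / (1 - r\<^sup>2)\<^sup>2 - 1 / (1 - r\<^sup>2)) - 2 * (r\<^sup>2 / (1 - r\<^sup>2)) + r / 2 * L) / 4 = 1"
  proof -
    assume *: "1 - r\<^sup>2 > 0" and **: "r\<^sup>2 * (2 - 3 * (1 - r\<^sup>2)) + r / 2 * L * (1 - r\<^sup>2)\<^sup>2 = 4 * (1 - r\<^sup>2)\<^sup>2"
    define q where "q = 1 - r\<^sup>2"
    have "r\<^sup>2 * (2 / q\<^sup>2 - 1 / q) - 2 * (r\<^sup>2 / q) + r / 2 * L = (r\<^sup>2 * (2 - 3 * q) + r / 2 * L * q\<^sup>2) / q\<^sup>2"
    proof -
      have "q \<noteq> 0" using * by (simp add: q_def)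
      then show ?thesis by (simp add: field_simps power2_eq_square)
    qed
    then show ?thesis using * ** by (simp add: q_def)
  qed
  then have w: "w sums 1" using even_coeffs_majorant_sums[OF r] by (simp add: w_def L_def)
  have partial: "(\<Sum>k<N. real k * y k * r ^ Suc k) \<le> 1" for N
  proof -
    have eq: "(\<Sum>k<N. real k * y k * r ^ Suc k) = (\<Sum>k<N. (sqrt (2 * real k + 1) * y k) * (real k / sqrt (2 * real k + 1) * r ^ Suc k))"
    proof (rule sum.cong[OF refl])
      fix k
      have "sqrt (2 * real k + 1) > 0" by simp
      then show "real k * y k * r ^ Suc k = (sqrt (2 * real k + 1) * y k) * (real k / sqrt (2 * real k + 1) * r ^ Suc k)"
        by (simp add: field_simps)
    qed
    have "(\<Sum>k<N. real k * y k * r ^ Suc k)\<^sup>2 \<le>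
        (\<Sum>k<N. (sqrt (2 * real k + 1) * y k)\<^sup>2) * (\<Sum>k<N. (real k / sqrt (2 * real k + 1) * r ^ Suc k)\<^sup>2)"
      unfolding eq by (rule Cauchy_Schwarz_ineq_sum)
    also have "(\<Sum>k<N. (sqrt (2 * real k + 1) * y k)\<^sup>2) = (\<Sum>k<N. (2 * real k + 1) * (y k)\<^sup>2)"
      by (simp add: power_mult_distrib)
    also have "(\<Sum>k<N. (real k / sqrt (2 * real k + 1) * r ^ Suc k)\<^sup>2) = (\<Sum>k<N. w k)"
    proof (rule sum.cong[OF refl])
      fix k
      have "(r ^ Suc k)\<^sup>2 = r ^ (2*k + 2)" by (simp add: power2_eq_square mult_2 flip: power_add)
      then show "(real k / sqrt (2 * real k + 1) * r ^ Suc k)\<^sup>2 = w k"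
        unfolding w_def power_mult_distrib power_divide by simp
    qed
    also have "(\<Sum>k<N. (2 * real k + 1) * (y k)\<^sup>2) * (\<Sum>k<N. w k) \<le> 1 * 1"
    proof (rule mult_mono)
      have "(\<Sum>k<N. w k) \<le> suminf w"
        using w r by (intro sum_le_suminf) (auto simp: sums_iff w_def)
      then show "(\<Sum>k<N. w k) \<le> 1" using w by (simp add: sums_iff)
      show "0 \<le> (\<Sum>k<N. w k)" using r by (intro sum_nonneg) (auto simp: w_def)
    qed (use area in auto)
    finally show ?thesis by (simp add: abs_square_le_1)
  qed
  show sm: "summable (\<lambda>k. real k * y k * r ^ Suc k)"
  proof (rule summableI_nonneg_bounded)
    show "0 \<le> real n * y n * r ^ Suc n" for n using y r by simp
    show "(\<Sum>k<n. real k * y k * r ^ Suc k) \<le> 1" for n by (rule partial)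
  qed
  show "(\<Sum>k. real k * y k * r ^ Suc k) \<le> 1"
    by (rule suminf_le_const[OF sm partial])
qed

section \<open>Transfer to \<open>F\<close>: membership in the class and univalence\<close>

theorem theorem6p1:
  fixes f :: "complex \<Rightarrow> complex" and b :: "nat \<Rightarrow> complex"
    and F :: "complex \<Rightarrow> complex" and r0 :: real
  assumes fA: "classA f"
    and f_univ: "inj_on f (ball 0 1)"
    and b_exp: "\<forall>z\<in>ball 0 1. z \<noteq> 0 \<longrightarrow>
                  (\<lambda>n. b (Suc n) * z ^ Suc n) sums (z / f z - 1)"
    and F_def: "\<forall>z. F z = z / (1 + (\<Sum>n. b (2 * Suc n) * z ^ Suc n))"
    and r0_range: "0 < r0" "r0 < 1"
    and r0_root: "r0 * (1 - r0\<^sup>2)\<^sup>2 / 2 * ln ((1 + r0) / (1 - r0)) - (4 + r0 ^ 4 - 7 * r0\<^sup>2) = 0"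
  shows "(\<forall>r. 0 < r \<and> r \<le> r0 \<longrightarrow> classU1 (\<lambda>z. F (of_real r * z) / of_real r))
         \<and> inj_on F (ball 0 r0)"
proof -
  \<comment> \<open>The given expansion starts at \<open>b 1\<close>; \<open>B\<close> supplies the
    constant term 1 at index 0.\<close>
  define B where "B = (\<lambda>n. if n = 0 then 1 else b n)"
  define p where "p = (\<lambda>z. if z = 0 then 1 else z / f z)"
  define \<beta> where "\<beta> = (\<lambda>n. B (2 * n))"
  define \<phi> where "\<phi> = (\<lambda>w. 1 + (\<Sum>n. b (2 * Suc n) * w ^ Suc n))"
  define y where "y = (\<lambda>k. norm (\<beta> (Suc k)))"
  have hol: "f holomorphic_on ball 0 1" and f0: "f 0 = 0" using fA by (auto simp: classA_def)
  have fne0: "f z \<noteq> 0" if "z \<noteq> 0" "norm z < 1" for z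
    using that inj_onD[OF f_univ, of z 0] f0 by auto
  have F: "F z = z / \<phi> z" for z using F_def by (simp add: \<phi>_def)
  have p_sums: "(\<lambda>n. B n * z ^ n) sums p z" if z: "norm z < 1" for z
  proof (cases "z = 0")
    case True
    then show ?thesis using powser_sums_zero[of B] by (simp add: p_def B_def)
  next
    case False
    then have "(\<lambda>n. B (Suc n) * z ^ Suc n) sums (p z - 1)"
      using b_exp z by (simp add: B_def p_def)
    then show ?thesis by (subst (asm) sums_Suc_iff) (simp add: B_def)
  qed
  \<comment> \<open>Averaging the series of \<open>p\<close> at \<open>z\<close> and
    \<open>- z\<close> removes the odd coefficients.\<close>
  have \<phi>_sq: "(\<lambda>n. \<beta> n * (z\<^sup>2) ^ n) sums ((p z + p (- z)) / 2)" if z: "norm z < 1" for z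
  proof -
    have "(\<lambda>n. (B n * z ^ n + B n * (- z) ^ n) / 2) sums ((p z + p (- z)) / 2)"
      using z by (intro sums_divide sums_add p_sums) auto
    then have "(\<lambda>n. (B (2 * n) * z ^ (2 * n) + B (2 * n) * (- z) ^ (2 * n)) / 2) sums ((p z + p (- z)) / 2)"
    proof (subst sums_mono_reindex)
      show "strict_mono (\<lambda>n::nat. 2 * n)" by (simp add: strict_mono_def)
      show "(B n * z ^ n + B n * (- z) ^ n) / 2 = 0" if "n \<notin> range (\<lambda>n. 2 * n)" for n
      proof -
        have "odd n" using that by (auto elim: evenE)
        then show ?thesis by simp
      qed
    qed
    then show ?thesis by (simp add: \<beta>_def power_mult)
  qed
  have \<phi>_unique: "\<phi> w = s" if "(\<lambda>n. \<beta> n * w ^ n) sums s" for w s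
  proof -
    have "(\<lambda>n. \<beta> (Suc n) * w ^ Suc n) sums (s - \<beta> 0 * w ^ 0)"
      using that sums_Suc_iff[of "\<lambda>n. \<beta> n * w ^ n"] by simp
    then have "(\<lambda>n. b (2 * Suc n) * w ^ Suc n) sums (s - 1)"
      by (simp add: \<beta>_def B_def)
    then show ?thesis by (simp add: \<phi>_def sums_iff)
  qed
  \<comment> \<open>Every point of the disc is the square of a point of the disc, so convergence of
    the series for \<open>\<phi>\<close> is inherited from \<open>p\<close>.\<close>
  have root: "\<exists>z. w = z\<^sup>2 \<and> norm z < 1" if "norm w < 1" for w :: complex
    using that by (intro exI[of _ "csqrt w"]) simp
  have \<phi>_sums: "(\<lambda>n. \<beta> n * w ^ n) sums \<phi> w" if "norm w < 1" for w
    using root[OF that] \<phi>_sq \<phi>_unique by metis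
  note \<phi>_ps = power_series_unit_disc[OF \<phi>_sums]
  have \<phi>_0: "\<phi> 0 = 1" by (simp add: \<phi>_def)
  have \<phi>_ne: "\<phi> w \<noteq> 0" if w: "norm w < 1" for w
  proof (cases "w = 0")
    case False
    obtain z where z: "w = z\<^sup>2" "norm z < 1" using root[OF w] by blast
    then have "z \<noteq> 0" using False by auto
    then have "z \<noteq> - z" by simp
    then have "f z \<noteq> f (- z)" using inj_onD[OF f_univ, of z "- z"] z by auto
    moreover have "f z \<noteq> 0" "f (- z) \<noteq> 0" using fne0 z \<open>z \<noteq> 0\<close> by auto
    ultimately have "p z + p (- z) \<noteq> 0" using \<open>z \<noteq> 0\<close> by (simp add: p_def field_simps)
    moreover have "\<phi> w = (p z + p (- z)) / 2" unfolding z(1) by (rule \<phi>_unique[OF \<phi>_sq[OF z(2)]])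
    ultimately show ?thesis by (simp only: divide_eq_0_iff) simp
  qed (simp add: \<phi>_0)

  \<comment> \<open>The coefficient \<open>B (2 * k + 2)\<close> sits at
    \<open>m = 2 * k + 1\<close> in the area sum; the terms with even \<open>m\<close> are
    nonnegative and are dropped.\<close>
  have area: "(\<Sum>k<N. (2 * real k + 1) * (y k)\<^sup>2) \<le> 1" for N
  proof -
    have "(\<Sum>k<N. (2 * real k + 1) * (y k)\<^sup>2) = (\<Sum>m\<in>(\<lambda>k. 2 * k + 1) ` {..<N}. real m * (norm (B (Suc m)))\<^sup>2)"
      by (subst sum.reindex) (auto simp: inj_on_def y_def \<beta>_def add.commute)
    also have "\<dots> \<le> (\<Sum>m<2*N. real m * (norm (B (Suc m)))\<^sup>2)"
      by (intro sum_mono2) auto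
    also have "\<dots> \<le> 1"
      using p_sums unfolding p_def by (intro area_theorem[OF hol f0 f_univ])
    finally show ?thesis .
  qed
  have y0: "y k \<ge> 0" for k by (simp add: y_def)
  note W = weighted_sum_le_one[of y, OF y0 area r0_range r0_root]

  \<comment> \<open>The comparison is always made with the weighted sum at \<open>r0\<close> itself,
    which covers all \<open>r \<le> r0\<close> at once. The extra factor
    \<open>(norm z / r0)^2\<close> gives strictness, also when \<open>r = r0\<close>.\<close>
  have U_bound: "norm (\<phi> z - z * deriv \<phi> z - 1) \<le> (norm z / r0)\<^sup>2" if z: "norm z < r0" for z
  proof -
    have z1: "norm z < 1" using z r0_range by linarith
    define t where "t = norm z / r0"
    have t: "0 \<le> t" "t \<le> 1" "norm z = t * r0" using z r0_range by (auto simp: t_def)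
    have "(\<lambda>n. \<beta> n * z ^ n - z * (of_nat n * \<beta> n * z ^ (n - 1))) sums (\<phi> z - z * deriv \<phi> z)"
      by (intro sums_diff sums_mult \<phi>_sums \<phi>_ps(2) z1)
    then have "(\<lambda>n. \<beta> (Suc n) * z ^ Suc n - z * (of_nat (Suc n) * \<beta> (Suc n) * z ^ (Suc n - 1))) sums (\<phi> z - z * deriv \<phi> z - 1)"
      by (subst sums_Suc_iff) (simp add: \<beta>_def B_def)
    then have "(\<lambda>n. - (of_nat n * \<beta> (Suc n) * z ^ Suc n)) sums (\<phi> z - z * deriv \<phi> z - 1)"
      by (simp add: algebra_simps)
    moreover have "norm (\<Sum>n. - (of_nat n * \<beta> (Suc n) * z ^ Suc n)) \<le> (\<Sum>k. t\<^sup>2 * (real k * y k * r0 ^ Suc k))"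
    proof (rule norm_suminf_le)
      fix n
      \<comment> \<open>The term \<open>n = 0\<close> vanishes, and otherwise the exponent is at
        least 2, so \<open>t^2\<close> can be pulled out.\<close>
      have "real n * t ^ Suc n \<le> real n * t\<^sup>2"
        using t by (cases n) (auto intro!: mult_left_mono power_decreasing simp del: power_Suc)
      then have "(real n * t ^ Suc n) * (y n * r0 ^ Suc n) \<le> (real n * t\<^sup>2) * (y n * r0 ^ Suc n)"
        using y0 r0_range by (intro mult_right_mono) auto
      moreover have "norm (- (of_nat n * \<beta> (Suc n) * z ^ Suc n)) = (real n * t ^ Suc n) * (y n * r0 ^ Suc n)"
        unfolding norm_minus_cancel norm_mult norm_power t(3) power_mult_distrib by (simp add: y_def mult_ac)
      ultimately show "norm (- (of_nat n * \<beta> (Suc n) * z ^ Suc n)) \<le> t\<^sup>2 * (real n * y n * r0 ^ Suc n)"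
        by (simp only: mult_ac)
    qed (intro summable_mult W)
    moreover have "(\<Sum>k. t\<^sup>2 * (real k * y k * r0 ^ Suc k)) \<le> t\<^sup>2"
      using mult_left_mono[OF W(2), of "t\<^sup>2"] by (simp only: suminf_mult[OF W(1)]) simp
    ultimately show ?thesis by (simp add: sums_iff t_def)
  qed

  have F_deriv: "(F has_field_derivative (\<phi> z - z * deriv \<phi> z) / (\<phi> z)\<^sup>2) (at z)" if z: "norm z < 1" for z
  proof -
    have "((\<lambda>z. z / \<phi> z) has_field_derivative (1 * \<phi> z - z * deriv \<phi> z) / (\<phi> z * \<phi> z)) (at z)"
      by (intro derivative_intros \<phi>_ps(1) \<phi>_ne z)
    then show ?thesis by (simp add: F[abs_def] power2_eq_square)
  qed
  have "classU1 (\<lambda>z. F (of_real r * z) / of_real r)" if r: "0 < r" "r \<le> r0" for r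
  proof -
    define G where "G = (\<lambda>z. F (of_real r * z) / of_real r)"
    have rz: "norm (of_real r * z) < r0 \<and> norm (of_real r * z) < 1 \<and> norm (of_real r * z) / r0 < 1"
      if "norm z < 1" for z :: complex
    proof -
      have "norm (of_real r * z) < r" using that r by (simp add: norm_mult)
      then have *: "norm (of_real r * z) < r0" using r by linarith
      moreover have "norm (of_real r * z) < 1" using * r0_range by linarith
      moreover have "norm (of_real r * z) / r0 < 1"
        unfolding divide_less_eq_1_pos[OF r0_range(1)] by (rule *)
      ultimately show ?thesis by blast
    qed
    have G_deriv: "(G has_field_derivative (\<phi> (r * z) - r * z * deriv \<phi> (r * z)) / (\<phi> (r * z))\<^sup>2) (at z)"
      if "norm z < 1" for z :: complex
    proof -
      have "((*) (complex_of_real r) has_field_derivative of_real r) (at z)"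
        by (auto intro!: derivative_eq_intros)
      from DERIV_cdivide[OF DERIV_chain2[OF F_deriv this], of "of_real r"] rz[OF that]
      show ?thesis using r by (simp add: G_def)
    qed
    have "classA G"
      unfolding classA_def
    proof (intro conjI)
      show "G holomorphic_on ball 0 1"
      proof (rule holomorphic_onI)
        fix z :: complex assume "z \<in> ball 0 1"
        then have "norm z < 1" by simp
        then show "G field_differentiable at z within ball 0 1"
          using G_deriv field_differentiable_at_within field_differentiable_def by blast
      qed
      show "G 0 = 0" by (simp add: G_def F)
      show "deriv G 0 = 1" using DERIV_imp_deriv[OF G_deriv[of 0]] by (simp add: \<phi>_0)
    qed
    moreover have G0: "G z \<noteq> 0" if "norm z < 1" "z \<noteq> 0" for z :: complex
      using rz[OF that(1)] that \<phi>_ne r by (auto simp: G_def F)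
    moreover have "norm (Uf G z) < 1" if z: "norm z < 1" for z :: complex
    proof (cases "z = 0")
      case False
      define w where "w = of_real r * z"
      have w: "norm w < r0" "norm w < 1" "norm w / r0 < 1" using rz[OF z] by (auto simp: w_def)
      have "z / G z = \<phi> w"
        using False r \<phi>_ne[OF w(2)] by (simp add: G_def F w_def)
      moreover have "deriv G z = (\<phi> w - w * deriv \<phi> w) / (\<phi> w)\<^sup>2"
        using DERIV_imp_deriv[OF G_deriv[OF z]] by (simp add: w_def)
      \<comment> \<open>Dilation only moves the argument: \<open>U_G\<close> at \<open>z\<close> is
        \<open>U_F\<close> at \<open>r * z\<close>.\<close>
      ultimately have "Uf G z = \<phi> w - w * deriv \<phi> w - 1"
        using False \<phi>_ne[OF w(2)] by (simp add: Uf_def)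
      then have "norm (Uf G z) \<le> (norm w / r0)\<^sup>2" using U_bound[OF w(1)] by simp
      also have "\<dots> < 1" using w r0_range by (simp add: abs_square_less_1)
      finally show ?thesis .
    qed (simp add: Uf_def)
    ultimately show ?thesis by (auto simp: classU1_def G_def[symmetric])
  qed
  moreover have "inj_on F (ball 0 r0)"
  proof -
    \<comment> \<open>Univalence is shown directly. With \<open>\<phi> z = 1 + z * h z\<close>, the
      equation \<open>F u = F v\<close> becomes \<open>u - v = u * v * (h u - h v)\<close>. Since
      \<open>|h'| \<le> 1 / r0^2\<close> on the convex disc and \<open>|u * v| < r0^2\<close>,
      distinct \<open>u\<close> and \<open>v\<close> are impossible.\<close>
    define h where "h = (\<lambda>z. \<Sum>k. \<beta> (Suc k) * z ^ k)"
    have h_sums: "(\<lambda>k. \<beta> (Suc k) * z ^ k) sums h z" if "norm z < 1" for z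
      unfolding h_def using sums_summable[OF \<phi>_sums[OF that]]
      by (intro summable_sums) (simp add: summable_powser_split_head)
    note h_ps = power_series_unit_disc[OF h_sums]
    have \<phi>_h: "\<phi> z = 1 + z * h z" if "norm z < 1" for z
      using powser_split_head(1)[OF sums_summable[OF \<phi>_sums[OF that]]] sums_unique[OF \<phi>_sums[OF that]]
      by (simp add: h_def \<beta>_def B_def mult.commute)
    have h_deriv: "norm (deriv h z) \<le> 1 / r0\<^sup>2" if z: "z \<in> ball 0 r0" for z
    proof -
      have z1: "norm z < 1" using z r0_range by simp
      have "norm (\<Sum>n. of_nat n * \<beta> (Suc n) * z ^ (n - 1)) \<le> (\<Sum>k. 1 / r0\<^sup>2 * (real k * y k * r0 ^ Suc k))"
      proof (rule norm_suminf_le)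
        fix n
        have "norm (of_nat n * \<beta> (Suc n) * z ^ (n - 1)) = real n * y n * norm z ^ (n - 1)"
          by (simp add: norm_mult norm_power y_def)
        also have "\<dots> \<le> real n * y n * r0 ^ (n - 1)"
          using z y0 by (intro mult_left_mono power_mono) auto
        \<comment> \<open>The truncated exponent \<open>n - 1\<close> at \<open>n = 0\<close> is
          harmless because of the factor \<open>real n\<close>.\<close>
        also have "\<dots> = 1 / r0\<^sup>2 * (real n * y n * r0 ^ Suc n)"
          using r0_range by (cases n) (auto simp: power2_eq_square)
        finally show "norm (of_nat n * \<beta> (Suc n) * z ^ (n - 1)) \<le> 1 / r0\<^sup>2 * (real n * y n * r0 ^ Suc n)" .
      qed (intro summable_mult W)
      also have "\<dots> \<le> 1 / r0\<^sup>2"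
        using mult_left_mono[OF W(2), of "1 / r0\<^sup>2"] by (simp only: suminf_mult[OF W(1)]) simp
      finally show ?thesis using h_ps(2)[of z] z1 by (simp add: sums_iff)
    qed
    show ?thesis
    proof (rule inj_onI, rule ccontr)
      fix u v assume uv: "u \<in> ball 0 r0" "v \<in> ball 0 r0" "F u = F v" "u \<noteq> v"
      then have n1: "norm u < 1" "norm v < 1" using r0_range by auto
      have nz: "u \<noteq> 0" "v \<noteq> 0"
        using uv \<phi>_ne[OF n1(1)] \<phi>_ne[OF n1(2)] by (auto simp: F)
      have "u * \<phi> v = v * \<phi> u"
        using uv(3) \<phi>_ne[OF n1(1)] \<phi>_ne[OF n1(2)] by (simp add: F field_simps)
      then have "u - v = u * v * (h u - h v)"
        using n1 by (simp add: \<phi>_h algebra_simps)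
      then have "norm (u - v) = norm u * norm v * norm (h u - h v)" by (metis norm_mult)
      also have "\<dots> \<le> norm u * norm v * (1 / r0\<^sup>2 * norm (u - v))"
      proof (rule mult_left_mono)
        show "norm (h u - h v) \<le> 1 / r0\<^sup>2 * norm (u - v)"
        proof (rule field_differentiable_bound[of "ball 0 r0" h "deriv h"])
          show "(h has_field_derivative deriv h z) (at z within ball 0 r0)" if "z \<in> ball 0 r0" for z
            using h_ps(1)[of z] that r0_range by (simp add: has_field_derivative_at_within)
        qed (use h_deriv uv in auto)
      qed simp
      also have "\<dots> = (norm u * norm v / r0\<^sup>2) * norm (u - v)" by simp
      also have "\<dots> < 1 * norm (u - v)"
      proof (rule mult_strict_right_mono)
        have "norm u * norm v < r0 * r0" using uv r0_range by (intro mult_strict_mono) auto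
        then show "norm u * norm v / r0\<^sup>2 < 1" using r0_range by (simp add: power2_eq_square)
      qed (use uv in simp)
      finally show False by simp
    qed
  qed
  ultimately show ?thesis by blast
qed

end
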